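(* Let $p$ be an odd prime and $k\in\mathbb{N}$. Then $(2p)(k)_{p+1}\in\mathbb{V}_{p+1}$ if and only if $p\nmid k$.
   Context: Natural numbers ($\mathbb{N}$) are positive integers. Every natural number $n$ has a unique base $b$ representation ($b\ge 2$) $n=a_0+a_1b+\cdots+a_{L-1}b^{L-1}$ with $L\ge 1$, integers $0\le a_i<b$ and $a_{L-1}\ne 0$; $L$ is the number of base $b$ digits of $n$. The digit reversal of $n$ in base $b$ is $r_b(n)=a_{L-1}+a_{L-2}b+\cdots+a_0b^{L-1}$. The function $v$ on natural numbers: if $n=p_1^{\varepsilon_1}\cdots p_s^{\varepsilon_s}q_1\cdots q_t$ with $s,t\ge 0$, integers $\varepsilon_i\ge 2$ and distinct primes $p_1,\dots,p_s,q_1,\dots,q_t$, then $v(n)=\sum_{i=1}^s(p_i+\varepsilon_i)+\sum_{j=1}^t q_j$ (so $v(1)=0$). A natural number $n$ is a $v$-palindrome in base $b$ if (i) $b\nmid n$, (ii) $n\ne r_b(n)$, and (iii) $v(n)=v(r_b(n))$. The set of $v$-palindromes in base $b$ is denoted $\mathbb{V}_b$. For a natural number $n$ with exactly $L$ base $b$ digits and an integer $k\ge 1$, $n(k)_b$ denotes the number whose base $b$ digits are $k$ concatenated copies of the base $b$ digits of $n$, i.e. $n(k)_b=n\,(1+b^L+\cdots+b^{(k-1)L})$. Thus $(2p)(k)_{p+1}$ is the $k$-fold repeated concatenation of $2p$ in base $p+1$. *)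

theory Defs
  imports "HOL-Computational_Algebra.Primes"
begin

text \<open>Least significant digit first. For \<open>b \<ge> 2\<close> and \<open>n > 0\<close> the two lemmas below identify this list
  as the unique base \<open>b\<close> representation of \<open>n\<close>; the value \<open>[]\<close> for \<open>b < 2\<close> is a junk value.\<close>

function digits :: "nat \<Rightarrow> nat \<Rightarrow> nat list" where
  "digits b n = (if b < 2 \<or> n = 0 then [] else (n mod b) # digits b (n div b))"
  by auto
termination by (relation "measure snd") auto

declare digits.simps [simp del]

definition of_digits :: "nat \<Rightarrow> nat list \<Rightarrow> nat" where
  "of_digits b ds = (\<Sum>i<length ds. ds ! i * b ^ i)"

lemma of_digits_Nil [simp]: "of_digits b [] = 0"
  by (simp add: of_digits_def)

lemma of_digits_Cons [simp]: "of_digits b (d # ds) = d + b * of_digits b ds"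
  unfolding of_digits_def length_Cons sum.lessThan_Suc_shift
  by (simp add: sum_distrib_left mult_ac)

lemma digits_correct:
  assumes "b \<ge> 2" and "n > 0"
  shows "of_digits b (digits b n) = n" and "\<forall>d \<in> set (digits b n). d < b"
    and "digits b n \<noteq> []" and "last (digits b n) \<noteq> 0"
proof -
  have "of_digits b (digits b n) = n \<and> (\<forall>d \<in> set (digits b n). d < b)
      \<and> digits b n \<noteq> [] \<and> last (digits b n) \<noteq> 0"
    using assms(2)
  proof (induction n rule: less_induct)
    case (less n)
    have eq: "digits b n = (n mod b) # digits b (n div b)"
      using less.prems assms(1) by (subst digits.simps) simp
    show ?case
    proof (cases "n div b = 0")
      case True
      then have "n < b" using assms(1) by (simp add: div_eq_0_iff)
      moreover have "digits b 0 = []" by (subst digits.simps) simp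
      ultimately show ?thesis using eq less.prems by simp
    next
      case False
      have "n div b < n" using assms(1) less.prems by simp
      then have IH: "of_digits b (digits b (n div b)) = n div b"
          "\<forall>d \<in> set (digits b (n div b)). d < b"
          "digits b (n div b) \<noteq> []" "last (digits b (n div b)) \<noteq> 0"
        using less.IH[of "n div b"] False by blast+
      have "n mod b < b" using assms(1) by simp
      moreover have "n mod b + b * (n div b) = n" by simp
      ultimately show ?thesis
        unfolding eq of_digits_Cons IH(1) using IH(2-4) by simp
    qed
  qed
  then show "of_digits b (digits b n) = n" "\<forall>d \<in> set (digits b n). d < b"
    "digits b n \<noteq> []" "last (digits b n) \<noteq> 0" by auto
qed

lemma digits_unique:
  assumes "b \<ge> 2" and "\<forall>d \<in> set ds. d < b" and "ds \<noteq> []" and "last ds \<noteq> 0"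
  shows "digits b (of_digits b ds) = ds"
  using assms(2-4)
proof (induction ds)
  case Nil
  then show ?case by simp
next
  case (Cons d ds)
  have z: "digits b 0 = []" by (subst digits.simps) simp
  have IH: "digits b (of_digits b ds) = ds"
    using Cons by (cases "ds = []") (auto simp: z)
  have "of_digits b (d # ds) \<noteq> 0"
  proof (cases "ds = []")
    case True
    then show ?thesis using Cons.prems by simp
  next
    case False
    then have "of_digits b ds \<noteq> 0" using IH z by metis
    then show ?thesis using assms(1) by simp
  qed
  then show ?case
    using Cons.prems(1) assms(1) IH by (subst digits.simps) auto
qed

definition digit_reversal :: "nat \<Rightarrow> nat \<Rightarrow> nat" where
  "digit_reversal b n = of_digits b (rev (digits b n))"

definition v :: "nat \<Rightarrow> nat" where
  "v n = (\<Sum>q \<in> prime_factors n.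
            if multiplicity q n \<ge> 2 then q + multiplicity q n else q)"

definition v_palindromes :: "nat \<Rightarrow> nat set" where
  "v_palindromes b = {n. n > 0 \<and> \<not> b dvd n \<and> n \<noteq> digit_reversal b n \<and> v n = v (digit_reversal b n)}"

definition repeated_concat :: "nat \<Rightarrow> nat \<Rightarrow> nat \<Rightarrow> nat" where
  "repeated_concat b n k = of_digits b (concat (replicate k (digits b n)))"

lemma of_digits_append: "of_digits b (xs @ ys) = of_digits b xs + b ^ length xs * of_digits b ys"
  by (induction xs) (simp_all add: algebra_simps)

lemma repeated_concat_eq:
  assumes "b \<ge> 2" and "n > 0"
  shows "repeated_concat b n k = n * (\<Sum>i<k. b ^ (i * length (digits b n)))"
proof (induction k)
  case 0
  then show ?case by (simp add: repeated_concat_def)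
next
  case (Suc k)
  show ?case
    using Suc digits_correct(1)[OF assms]
    unfolding repeated_concat_def sum.lessThan_Suc_shift
    by (simp add: of_digits_append power_add sum_distrib_left algebra_simps)
qed

end

theory Submission
  imports Defs "HOL-Number_Theory.Cong"
begin

text \<open>
  In base \<open>p + 1\<close> the number \<open>2 p = (p - 1) + 1 (p + 1)\<close> has the two digits \<open>1\<close> and \<open>p - 1\<close>, and
  its reversal is \<open>1 + (p - 1) (p + 1) = p\<^sup>2\<close>. Reversing a repeated concatenation reverses each of
  its blocks, so the number and its reversal are \<open>2 p R\<close> and \<open>p\<^sup>2 R\<close> with the same cofactor
  \<open>R = 1 + (p + 1)\<^sup>2 + \<dots> + (p + 1)\<^bsup>2(k - 1)\<^esup>\<close>. These differ because \<open>p \<noteq> 2\<close>. As \<open>R\<close> is \<open>1\<close> modulo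
  the even number \<open>p + 1\<close>, it is odd; and since \<open>p R\<close> is coprime to \<open>p + 1\<close>, the base divides
  \<open>2 p R\<close> only if it divides \<open>2\<close>, which is impossible. So everything depends on comparing \<open>v (2 p R)\<close> with \<open>v (p\<^sup>2 R)\<close>.

  The function \<open>v\<close> is additive over coprime factors. With \<open>R = p\<^bsup>e\<^esup> m\<close> and \<open>p\<close> not dividing \<open>m\<close>,
  the comparison is between \<open>2 + v (p\<^bsup>e + 1\<^esup>)\<close> and \<open>v (p\<^bsup>e + 2\<^esup>)\<close>. The second value is always
  \<open>p + e + 2\<close>. The first is \<open>2 + p\<close> for \<open>e = 0\<close>, where \<open>p\<close> occurs to the first power and its exponent
  does not count, but \<open>p + e + 3\<close> for \<open>e \<ge> 1\<close>. Hence equality means that \<open>p\<close> does not divide \<open>R\<close>,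
  and since \<open>p + 1\<close> is \<open>1\<close> modulo \<open>p\<close>, the sum \<open>R\<close> is \<open>k\<close> modulo \<open>p\<close>.
\<close>

section \<open>Values of the function v\<close>

lemma v_mult_coprime:
  assumes "coprime m n" "m > 0" "n > 0"
  shows "v (m * n) = v m + v n"
proof -
  have disj: "prime_factors m \<inter> prime_factors n = {}"
    using assms(1) by (meson coprime_common_divisor disjoint_iff in_prime_factors_imp_dvd
        in_prime_factors_imp_prime not_prime_unit)
  have union: "prime_factors (m * n) = prime_factors m \<union> prime_factors n"
    using assms by (simp add: prime_factors_product)
  have left: "multiplicity q (m * n) = multiplicity q m" if "q \<in> prime_factors m" for q
  proof -
    have "prime q" "\<not> q dvd n" using that assms disj by (auto simp: in_prime_factors_iff)
    then show ?thesis
      using assms by (simp add: prime_elem_multiplicity_mult_distrib not_dvd_imp_multiplicity_0)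
  qed
  have right: "multiplicity q (m * n) = multiplicity q n" if "q \<in> prime_factors n" for q
  proof -
    have "prime q" "\<not> q dvd m" using that assms disj by (auto simp: in_prime_factors_iff)
    then show ?thesis
      using assms by (simp add: prime_elem_multiplicity_mult_distrib not_dvd_imp_multiplicity_0)
  qed
  show ?thesis
    unfolding v_def union using disj
    by (subst sum.union_disjoint) (auto simp: left right intro!: arg_cong2[where f = "(+)"] sum.cong)
qed

lemma v_prime: "prime q \<Longrightarrow> v q = q"
  by (simp add: v_def prime_factorization_prime)

lemma v_prime_power:
  assumes "prime q" "e \<ge> 2"
  shows "v (q ^ e) = q + e"
proof -
  have "prime_factors (q ^ e) = {q}"
    using assms by (simp add: prime_factorization_prime_power)
  moreover have "multiplicity q (q ^ e) = e"
    using assms by (intro multiplicity_same_power) auto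
  ultimately show ?thesis
    using assms by (simp add: v_def)
qed

text \<open>Giving a further factor \<open>p\<close> to a multiple of \<open>p\<close> raises \<open>v\<close> by \<open>1\<close>, except that it raises \<open>v\<close>
  by \<open>2\<close> when \<open>p\<close> occurred to the first power. A factor \<open>2\<close> given to an odd number adds \<open>2\<close> as well,
  so the factors \<open>2\<close> and \<open>p\<close> have the same effect on \<open>p R\<close> exactly in the exceptional case.\<close>

lemma v_two_mult_prime_eq_iff:
  assumes "prime p" "odd p" "odd R"
  shows "v (2 * p * R) = v (p ^ 2 * R) \<longleftrightarrow> \<not> p dvd R"
proof -
  have "R \<noteq> 0" using assms(3) by (cases R) auto
  have "p > 1" using assms(1) by (rule prime_gt_1_nat)
  obtain m where R: "R = p ^ multiplicity p R * m" and m: "\<not> p dvd m"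
    using multiplicity_decompose'[of R p] \<open>R \<noteq> 0\<close> \<open>p > 1\<close> by auto
  define e where "e = multiplicity p R"
  have "m > 0" using m by (cases m) auto
  have cop: "coprime (p ^ i) m" for i
    using m assms by (simp add: prime_imp_coprime)
  have "odd m" using assms(3) by (subst (asm) R) auto
  have "coprime 2 (p ^ Suc e * m)"
    using \<open>odd m\<close> \<open>odd p\<close> by (simp add: coprime_left_2_iff_odd)
  moreover have "2 * p * R = 2 * (p ^ Suc e * m)"
    by (subst R) (simp add: e_def)
  ultimately have 1: "v (2 * p * R) = 2 + (v (p ^ Suc e) + v m)"
    using v_mult_coprime[of 2 "p ^ Suc e * m"] v_mult_coprime[OF cop[of "Suc e"]] v_prime[of 2]
      \<open>m > 0\<close> \<open>p > 1\<close>
    by (simp add: mult.assoc)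
  have "p ^ 2 * R = p ^ (e + 2) * m"
    by (subst R) (simp add: e_def power2_eq_square)
  then have 2: "v (p ^ 2 * R) = p + (e + 2) + v m"
    using v_mult_coprime[OF cop[of "e + 2"]] v_prime_power[OF assms(1), of "e + 2"]
      \<open>m > 0\<close> \<open>p > 1\<close> by simp
  have "e = 0 \<longleftrightarrow> \<not> p dvd R"
    using \<open>R \<noteq> 0\<close> \<open>p > 1\<close> by (simp add: e_def multiplicity_eq_zero_iff)
  moreover have "v (2 * p * R) = v (p ^ 2 * R) \<longleftrightarrow> e = 0"
  proof (cases "e = 0")
    case True
    then show ?thesis using 1 2 v_prime[OF assms(1)] by simp
  next
    case False
    then show ?thesis using 1 2 v_prime_power[OF assms(1), of "Suc e"] by simp
  qed
  ultimately show ?thesis by simp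
qed

section \<open>Reversal of repeated concatenations\<close>

lemma of_digits_concat_replicate:
  "of_digits b (concat (replicate k ds)) = of_digits b ds * (\<Sum>i<k. b ^ (i * length ds))"
proof (induction k)
  case 0
  then show ?case by simp
next
  case (Suc k)
  then show ?case
    unfolding sum.lessThan_Suc_shift
    by (simp add: of_digits_append power_add sum_distrib_left algebra_simps)
qed

lemma rev_concat_replicate: "rev (concat (replicate k ds)) = concat (replicate k (rev ds))"
  by (simp add: rev_concat)

lemma digit_reversal_repeated_concat:
  assumes "b \<ge> 2" "n > 0" "k \<ge> 1"
  shows "digit_reversal b (repeated_concat b n k)
       = digit_reversal b n * (\<Sum>i<k. b ^ (i * length (digits b n)))"
proof -
  let ?ds = "digits b n"
  let ?cs = "concat (replicate k ?ds)"
  note ds = digits_correct[OF assms(1,2)]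
  obtain j where k: "replicate k ?ds = replicate j ?ds @ [?ds]"
    using assms(3) by (metis One_nat_def Suc_le_D replicate_Suc replicate_append_same)
  have "digits b (of_digits b ?cs) = ?cs"
  proof (rule digits_unique)
    show "?cs \<noteq> []" "last ?cs \<noteq> 0" unfolding k using ds by simp_all
    show "\<forall>d\<in>set ?cs. d < b" using ds by auto
  qed (use assms in simp)
  then show ?thesis
    by (simp add: digit_reversal_def repeated_concat_def rev_concat_replicate
        of_digits_concat_replicate)
qed

section \<open>The repeated concatenations of 2p in base p + 1\<close>

lemma digits_two_mult:
  assumes "p \<ge> 2"
  shows "digits (p + 1) (2 * p) = [p - 1, 1]"
  using digits_unique[of "p + 1" "[p - 1, 1]"] assms by (simp add: mult_2)

lemma digit_reversal_two_mult:
  assumes "p \<ge> 2"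
  shows "digit_reversal (p + 1) (2 * p) = p ^ 2"
proof -
  obtain q where "p = Suc q" using assms by (cases p) auto
  then show ?thesis
    unfolding digit_reversal_def digits_two_mult[OF assms] by (simp add: power2_eq_square)
qed

lemma coprime_base_sum_powers:
  fixes b k l :: nat
  assumes "k \<ge> 1" "l \<ge> 1"
  shows "coprime b (\<Sum>i<k. b ^ (i * l))"
proof -
  obtain j where k: "k = Suc j" using assms by (cases k) auto
  have "(\<Sum>i<k. b ^ (i * l)) = 1 + b * (\<Sum>i<j. b ^ (l - 1 + i * l))"
    unfolding k sum.lessThan_Suc_shift sum_distrib_left
    using assms by (simp flip: power_Suc)
  then show ?thesis
    by (metis coprime_1_right coprime_iff_gcd_eq_1 gcd_add_mult mult.commute add.commute)
qed

lemma cong_sum_powers: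
  fixes p k l :: nat
  shows "[(\<Sum>i<k. (p + 1) ^ (i * l)) = k] (mod p)"
proof -
  have "[(p + 1) ^ (i * l) = 1 ^ (i * l)] (mod p)" for i
    by (intro cong_pow) (metis cong_add_lcancel_0_nat cong_def mod_add_self1)
  then have "[(\<Sum>i<k. (p + 1) ^ (i * l)) = (\<Sum>i<k. 1)] (mod p)"
    by (intro cong_sum) simp
  then show ?thesis by simp
qed

theorem theorem9:
  fixes p k :: nat
  assumes "prime p" and "odd p" and "k \<ge> 1"
  shows "repeated_concat (p + 1) (2 * p) k \<in> v_palindromes (p + 1) \<longleftrightarrow> \<not> p dvd k"
proof -
  have "p \<ge> 3"
    using assms(1,2) prime_ge_2_nat[of p] by (cases "p = 2") auto
  define R where "R = (\<Sum>i<k. (p + 1) ^ (i * 2))"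
  let ?N = "repeated_concat (p + 1) (2 * p) k"
  have len: "length (digits (Suc p) (2 * p)) = 2"
    using \<open>p \<ge> 3\<close> digits_two_mult[of p] by simp
  have N: "?N = 2 * p * R"
    using \<open>p \<ge> 3\<close> by (subst repeated_concat_eq) (simp_all add: R_def len)
  have rev: "digit_reversal (p + 1) ?N = p ^ 2 * R"
    using \<open>p \<ge> 3\<close> assms(3) digit_reversal_two_mult[of p]
    by (subst digit_reversal_repeated_concat) (simp_all add: R_def len)
  have cop: "coprime (p + 1) R"
    unfolding R_def using assms(3) by (intro coprime_base_sum_powers) auto
  have "odd R"
    using cop assms(2) by (metis coprime_common_divisor odd_one even_plus_one_iff odd_even_add)
  then have "R > 0" by (cases R) auto
  have "\<not> (p + 1) dvd ?N"
  proof
    assume "(p + 1) dvd ?N"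
    then have "(p + 1) dvd 2 * (p * R)" unfolding N by (simp add: mult.assoc)
    moreover have "coprime (p + 1) (p * R)" using cop by simp
    ultimately have "(p + 1) dvd 2" by (simp add: coprime_dvd_mult_left_iff)
    then show False using \<open>p \<ge> 3\<close> by (auto dest: dvd_imp_le)
  qed
  moreover have "?N \<noteq> digit_reversal (p + 1) ?N"
    unfolding rev unfolding N using \<open>p \<ge> 3\<close> \<open>R > 0\<close> by (simp add: power2_eq_square)
  moreover have "?N > 0" unfolding N using \<open>p \<ge> 3\<close> \<open>R > 0\<close> by simp
  ultimately have "?N \<in> v_palindromes (p + 1) \<longleftrightarrow> v (2 * p * R) = v (p ^ 2 * R)"
    unfolding v_palindromes_def using rev N by simp
  also have "\<dots> \<longleftrightarrow> \<not> p dvd R"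
    using assms(1,2) \<open>odd R\<close> by (rule v_two_mult_prime_eq_iff)
  also have "\<dots> \<longleftrightarrow> \<not> p dvd k"
    using cong_dvd_iff[OF cong_sum_powers[where k = k and l = 2]] by (simp add: R_def)
  finally show ?thesis .
qed

end
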